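(* For all integers $n\ge0$, $$\xi_{-1}(5n+4)\equiv0\pmod5 .$$
   Context: The numbers $\xi_{-1}(n)\in\mathbb{Z}$ ($n\ge 0$) are defined by the formal power series identity $$\sum_{n=0}^\infty \xi_{-1}(n)q^n=F((1-q)^{-1})=\sum_{n=0}^\infty\prod_{i=1}^n\left(1-(1-q)^{-i}\right),\qquad F(q)=\sum_{n=0}^\infty\prod_{i=1}^n(1-q^i),$$ where $(1-q)^{-i}$ is expanded as a formal power series in $q$; the sum is well defined in $\mathbb{Z}[[q]]$ because the $n$-th summand of $F((1-q)^{-1})$ is divisible by $q^n$. *)

theory Defs
  imports "HOL-Computational_Algebra.Formal_Power_Series" "HOL-Number_Theory.Cong"
begin

(* The series is a limit in the library's q-adic topology on Z[[q]].  It converges when u has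
   constant coefficient 1; the only use below is at u = 1/(1-q), see sums_F_series_xi. *)
definition F_series :: "int fps \<Rightarrow> int fps" where
  "F_series u = (\<Sum>n. \<Prod>i=1..n. (1 - u ^ i))"

(* "inverse" on power series needs an inverse operation on the coefficients, which int lacks; the
   second argument of fps_right_inverse is the inverse of the constant coefficient. *)
definition inv_one_minus_q :: "int fps" where
  "inv_one_minus_q = fps_right_inverse (1 - fps_X) 1"

definition xi_minus_one :: "nat \<Rightarrow> int" where
  "xi_minus_one n = fps_nth (F_series inv_one_minus_q) n"

lemma inv_one_minus_q_inverse: "(1 - fps_X) * inv_one_minus_q = 1"
  unfolding inv_one_minus_q_def by (rule fps_right_inverse) simp

lemma F_series_term_nth_eq_0:
  fixes u :: "int fps"
  assumes "fps_nth u 0 = 1" "k < n"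
  shows "fps_nth (\<Prod>i=1..n. (1 - u ^ i)) k = 0"
proof -
  have dvd: "fps_X dvd 1 - u ^ i" for i
  proof -
    have "fps_nth (1 - u ^ i) 0 = 0"
      using assms(1) by (simp add: fps_nth_power_0)
    then have "1 - u ^ i = fps_X * fps_shift 1 (1 - u ^ i)"
      by (intro fps_ext) (simp del: fps_sub_nth)
    then show ?thesis by (rule dvdI)
  qed
  have "(\<Prod>i=1..n. fps_X) dvd (\<Prod>i=1..n. (1 - u ^ i))"
    by (rule prod_dvd_prod) (rule dvd)
  then have "fps_X ^ n dvd (\<Prod>i=1..n. (1 - u ^ i))" by simp
  then obtain v where "(\<Prod>i=1..n. (1 - u ^ i)) = fps_X ^ n * v" by (rule dvdE)
  with \<open>k < n\<close> show ?thesis by (simp add: fps_X_power_mult_nth)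
qed

lemma sums_F_series:
  fixes u :: "int fps"
  assumes "fps_nth u 0 = 1"
  shows "(\<lambda>n. \<Prod>i=1..n. (1 - u ^ i)) sums
           Abs_fps (\<lambda>k. \<Sum>n\<le>k. fps_nth (\<Prod>i=1..n. (1 - u ^ i)) k)"
  unfolding sums_def
proof (rule tendsto_fpsI)
  fix k
  have "(\<Sum>n<N. fps_nth (\<Prod>i=1..n. (1 - u ^ i)) k)
      = (\<Sum>n\<le>k. fps_nth (\<Prod>i=1..n. (1 - u ^ i)) k)" if "N > k" for N
    using that F_series_term_nth_eq_0[OF assms]
    by (intro sum.mono_neutral_right) auto
  then show "\<forall>\<^sub>F N in sequentially. fps_nth (\<Sum>n<N. \<Prod>i=1..n. (1 - u ^ i)) k
      = fps_nth (Abs_fps (\<lambda>k. \<Sum>n\<le>k. fps_nth (\<Prod>i=1..n. (1 - u ^ i)) k)) k"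
    by (intro eventually_sequentiallyI[of "Suc k"]) (simp add: fps_sum_nth)
qed

lemma sums_F_series_xi:
  "(\<lambda>n. \<Prod>i=1..n. (1 - inv_one_minus_q ^ i)) sums Abs_fps xi_minus_one"
proof -
  have "fps_nth inv_one_minus_q 0 = 1" by (simp add: inv_one_minus_q_def)
  from sums_F_series[OF this]
  have "(\<lambda>n. \<Prod>i=1..n. (1 - inv_one_minus_q ^ i)) sums F_series inv_one_minus_q"
    unfolding F_series_def by (rule summable_sums[OF sums_summable])
  moreover have "F_series inv_one_minus_q = Abs_fps xi_minus_one"
    by (simp add: fps_eq_iff xi_minus_one_def)
  ultimately show ?thesis by simp
qed

end

theory Submission
  imports Defs
begin

text \<open>
  Put \<open>p = 1 - t\<close>, where \<open>t\<close> is the variable of the power series, so that the generating function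
  is \<open>F(1/p)\<close>.

  Zagier's series \<open>S(x) = \<Sum>n. (1 - x) (1 - q x) \<dots> (1 - q^n x) x^n\<close> satisfies
  \<open>S(x) = 1 - q x\<^sup>2 - q\<^sup>2 x\<^sup>3 S(q x)\<close>, and \<open>S(x) / (1 - x)\<close> formally tends to \<open>F(q)\<close> as \<open>x\<close>
  tends to 1. With \<open>q = 1/p\<close> the limit is taken along \<open>x = p^k\<close>, \<open>k = 5^r\<close>: since
  \<open>p^k = 1 - t^k\<close> modulo 5, these points converge \<open>t\<close>-adically to 1. At such a point the series
  terminates, and \<open>S(x) / (1 - x)\<close> agrees with \<open>F(1/p)\<close> modulo 5 and \<open>t^k\<close>
  (\<open>xi_minus_one_cong\<close>). On the other hand, iterating the functional equation
  (\<open>zagier_theta_Suc\<close>) writes \<open>S(p^k)\<close> as a signed sum of powers \<open>p^e\<close> whose exponents, for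
  \<open>5 dvd k\<close>, are negatives of generalized pentagonal numbers modulo 5, that is 0, 3 or 4.

  If \<open>e\<close> is 0 or 3 modulo 5, then \<open>p^e = (1 - t^5)^(e div 5) p^(e mod 5)\<close> modulo 5 has no term
  \<open>t^(5 n + 4)\<close> (\<open>power_vanishing\<close>). The powers with \<open>e\<close> equal to 4 modulo 5 add up to a multiple
  of a smaller sum of the same kind, with \<open>k\<close> replaced by \<open>k / 5\<close> and \<open>p\<close> by \<open>p^25\<close>
  (\<open>zagier_theta_mult_5\<close>); this reflects the fact that, for \<open>N\<close> coprime to 6,
  \<open>(N\<^sup>2 - 1) / 24\<close> is 1 modulo 5 exactly when 5 divides \<open>N\<close>. The smaller sum is divisible by
  \<open>1 - (p^25)^(k/5) = 1 - p^(5 k)\<close>, which is \<open>t^(5 k)\<close> modulo 5. Dividing \<open>S(p^k)\<close> by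
  \<open>1 - p^k\<close>, which is \<open>t^k\<close> modulo 5, only shifts exponents by \<open>k\<close>, a multiple of 5, so for
  \<open>5 n + 4 < k\<close> the smaller sum has no effect modulo 5 on the coefficient of \<open>t^(5 n + 4)\<close>.
\<close>

section \<open>Terminating values of Zagier's series\<close>

text \<open>
  This is \<open>S(x) / (1 - x)\<close> at \<open>x = y^k\<close> for \<open>q = 1/y\<close>. From \<open>n = k\<close> on the products contain the
  factor \<open>1 - q^k x = 0\<close>, so the sum over \<open>n < k\<close> is the whole series.
\<close>

definition zagier_sum :: "nat \<Rightarrow> 'a::comm_ring_1 \<Rightarrow> 'a" where
  "zagier_sum k y = (\<Sum>n<k. y ^ (k * n) * (\<Prod>i=1..n. (1 - y ^ (k - i))))"

text \<open>
  This is \<open>S(y^k)\<close>. By its recurrence it is a truncated partial theta series, read backwards.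
\<close>

definition zagier_theta :: "nat \<Rightarrow> 'a::comm_ring_1 \<Rightarrow> 'a" where
  "zagier_theta k y = (1 - y ^ k) * zagier_sum k y"

lemma zagier_theta_0 [simp]: "zagier_theta 0 y = 0"
  by (simp add: zagier_theta_def)

text \<open>
  Zagier's functional equation \<open>S(x) = 1 - q x\<^sup>2 - q\<^sup>2 x\<^sup>3 S(q x)\<close> at \<open>q = 1/y\<close>, \<open>x = y^(j+1)\<close>.
  The \<open>n\<close>-th terms of \<open>S(x)\<close> and \<open>q\<^sup>2 x\<^sup>3 S(q x)\<close> add up to \<open>c n - c (n + 1)\<close>, where
  \<open>c n = x^n (1 - q x) \<dots> (1 - q^n x) (1 - q^(n+1) x\<^sup>2)\<close>, so the sum telescopes.
\<close>

lemma zagier_theta_Suc: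
  "zagier_theta (Suc j) y = 1 - y ^ (2 * j + 1) - y ^ (3 * j + 1) * zagier_theta j y"
proof -
  define x where "x = y ^ Suc j"
  define U where "U n = (\<Prod>i=1..n. (1 - y ^ (Suc j - i)))" for n
  define c where "c n = x ^ n * U n * (1 - x * y ^ (j - n))" for n
  have U_Suc: "U (Suc n) = U n * (1 - y ^ (j - n))" for n
    by (simp add: U_def)
  have U_shift: "U (Suc n) = (1 - y ^ j) * (\<Prod>i=1..n. (1 - y ^ (j - i)))" for n
  proof (induction n)
    case (Suc n)
    then show ?case unfolding U_Suc [of "Suc n"] by (simp add: mult.assoc)
  qed (simp add: U_def)
  have U_last: "U (Suc j) = 0"
    by (simp add: U_Suc)
  \<comment> \<open>At \<open>n = j\<close> the truncated exponent \<open>j - Suc n\<close> in \<open>c (Suc n)\<close> is harmless because \<open>U (Suc j) = 0\<close>.\<close>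
  have "(1 - x) * (x ^ n * U n) + y ^ (3 * j + 1) * (y ^ (j * n) * U (Suc n)) = c n - c (Suc n)"
    if "n < Suc j" for n
  proof (cases "n = j")
    case True
    then have "(1 - y ^ (j - n)) = 0" by simp
    then show ?thesis using True by (simp add: c_def U_last algebra_simps)
  next
    case False
    with that obtain d where d: "j = n + Suc d"
      by (metis less_Suc_eq less_imp_Suc_add add_Suc_right)
    have e: "y ^ (3 * j + 1) * y ^ (j * n) = x ^ n * x\<^sup>2 * y ^ (j - Suc n)"
      unfolding x_def d power_add [symmetric] power_mult [symmetric]
      by (rule arg_cong [where f = "power y"]) (simp add: algebra_simps)
    have "(1 - x) * (x ^ n * U n) + (y ^ (3 * j + 1) * y ^ (j * n)) * U (Suc n) = c n - c (Suc n)"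
      unfolding e c_def U_Suc by (simp add: algebra_simps power2_eq_square)
    then show ?thesis by (simp add: mult.assoc)
  qed
  then have "(\<Sum>n<Suc j. (1 - x) * (x ^ n * U n) + y ^ (3 * j + 1) * (y ^ (j * n) * U (Suc n)))
      = (\<Sum>n<Suc j. c n - c (Suc n))"
    by (intro sum.cong) auto
  also have "\<dots> = 1 - y ^ (2 * j + 1)"
    unfolding sum_lessThan_telescope'
    by (simp add: c_def U_last) (simp add: U_def x_def mult_2 power_add)
  finally have "zagier_theta (Suc j) y
      + y ^ (3 * j + 1) * (\<Sum>n<Suc j. y ^ (j * n) * U (Suc n)) = 1 - y ^ (2 * j + 1)"
    unfolding zagier_theta_def zagier_sum_def sum.distrib sum_distrib_left U_def x_def power_mult .
  moreover have "(\<Sum>n<Suc j. y ^ (j * n) * U (Suc n)) = zagier_theta j y"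
  proof -
    have "(\<Sum>n<Suc j. y ^ (j * n) * U (Suc n)) = (\<Sum>n<j. y ^ (j * n) * U (Suc n))"
      by (simp add: U_last)
    also have "\<dots> = (\<Sum>n<j. (1 - y ^ j) * (y ^ (j * n) * (\<Prod>i=1..n. (1 - y ^ (j - i)))))"
      unfolding U_shift by (simp only: mult.left_commute)
    finally show ?thesis
      by (simp only: zagier_theta_def zagier_sum_def sum_distrib_left)
  qed
  ultimately show ?thesis by (simp only: eq_diff_eq)
qed

text \<open>
  Five steps at once, because the residues of the exponents modulo 5 are periodic in \<open>N\<close> with
  period 5. For \<open>5 dvd N\<close> every exponent outside the last summand is 0 or 3 modulo 5, except
  \<open>2 N + 9\<close> and \<open>12 N + 34\<close>.
\<close>

lemma zagier_theta_add_5: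
  "zagier_theta (N + 5) y =
     1 - y ^ (2*N+9) - y ^ (3*N+13) + y ^ (5*N+20) + y ^ (6*N+23) - y ^ (8*N+28)
     - y ^ (9*N+30) + y ^ (11*N+33) + y ^ (12*N+34) - y ^ (14*N+35)
     - y ^ (15*N+35) * zagier_theta N y"
proof -
  have step: "zagier_theta k y = 1 - y ^ a - y ^ b * zagier_theta j y"
    if "k = Suc j" "a = 2 * j + 1" "b = 3 * j + 1" for k j a b
    using that zagier_theta_Suc [of j y] by simp
  have "zagier_theta (N + 1) y = 1 - y ^ (2*N+1) - y ^ (3*N+1) * zagier_theta N y"
    "zagier_theta (N + 2) y = 1 - y ^ (2*N+3) - y ^ (3*N+4) * zagier_theta (N + 1) y"
    "zagier_theta (N + 3) y = 1 - y ^ (2*N+5) - y ^ (3*N+7) * zagier_theta (N + 2) y"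
    "zagier_theta (N + 4) y = 1 - y ^ (2*N+7) - y ^ (3*N+10) * zagier_theta (N + 3) y"
    "zagier_theta (N + 5) y = 1 - y ^ (2*N+9) - y ^ (3*N+13) * zagier_theta (N + 4) y"
    by (rule step; simp)+
  then show ?thesis
    by (simp only: right_diff_distrib mult_1_right mult.assoc [symmetric] power_add [symmetric])
      (simp add: algebra_simps)
qed

lemma dvd_diff_mult:
  fixes a b c d e :: "'a::comm_ring_1"
  assumes "e dvd a - b" "e dvd c - d"
  shows "e dvd a * c - b * d"
proof -
  have "a * c - b * d = (a - b) * c + b * (c - d)" by (simp add: algebra_simps)
  then show ?thesis using assms by simp
qed

text \<open>Modulo \<open>1 - y^k\<close> the factor \<open>y^k\<close> disappears, and \<open>y^(k - i)\<close> becomes \<open>y^(-i) = v^i\<close>.\<close>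

lemma dvd_zagier_sum_diff:
  fixes y v :: "'a::comm_ring_1"
  assumes "y * v = 1"
  shows "1 - y ^ k dvd zagier_sum k y - (\<Sum>n<k. \<Prod>i=1..n. (1 - v ^ i))"
proof -
  let ?d = "1 - y ^ k"
  have factor: "?d dvd (1 - y ^ (k - i)) - (1 - v ^ i)" if "i \<le> k" for i
  proof -
    have "y ^ k * v ^ i = y ^ (k - i) * (y ^ i * v ^ i)"
      using that by (simp add: mult.assoc [symmetric] power_add [symmetric])
    also have "y ^ i * v ^ i = 1"
      using assms by (simp add: power_mult_distrib [symmetric])
    finally have "y ^ k * v ^ i = y ^ (k - i)" by simp
    then have "(1 - y ^ (k - i)) - (1 - v ^ i) = ?d * v ^ i"
      by (simp add: algebra_simps)
    then show ?thesis by simp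
  qed
  have product: "?d dvd (\<Prod>i=1..n. (1 - y ^ (k - i))) - (\<Prod>i=1..n. (1 - v ^ i))" if "n \<le> k" for n
    using that
  proof (induction n)
    case (Suc n)
    then show ?case
      using dvd_diff_mult [OF Suc.IH factor [of "Suc n"]] by (simp add: mult.commute)
  qed simp
  have "?d dvd y ^ (k * n) * (\<Prod>i=1..n. (1 - y ^ (k - i))) - 1 * (\<Prod>i=1..n. (1 - v ^ i))"
    if "n < k" for n
  proof (rule dvd_diff_mult)
    have "1 - (y ^ k) ^ n = ?d * (\<Sum>i<n. (y ^ k) ^ i)"
      by (rule one_diff_power_eq)
    then show "?d dvd y ^ (k * n) - 1"
      by (metis dvd_minus_iff dvd_triv_left minus_diff_eq power_mult)
  qed (use that product in simp)
  then show ?thesis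
    unfolding zagier_sum_def sum_subtractf [symmetric] by (intro dvd_sum) simp
qed

section \<open>Fifth powers modulo 5\<close>

abbreviation (input) p :: "int fps" where "p \<equiv> 1 - fps_X"

lemma fps_nth_dvd_5:
  fixes f :: "int fps"
  assumes "5 dvd f"
  shows "5 dvd fps_nth f n"
proof -
  from assms obtain g where "f = 5 * g" by (rule dvdE)
  then show ?thesis by (simp add: fps_numeral_fps_const)
qed

lemma freshman_5:
  fixes a b :: "'a::comm_ring_1"
  shows "5 dvd (a - b) ^ 5 - (a ^ 5 - b ^ 5)"
proof
  show "(a - b) ^ 5 - (a ^ 5 - b ^ 5)
      = 5 * (- (a ^ 4 * b) + 2 * a ^ 3 * b ^ 2 - 2 * a ^ 2 * b ^ 3 + a * b ^ 4)"
    by (simp add: algebra_simps power2_eq_square eval_nat_numeral)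
qed

lemma one_minus_power_5:
  fixes x :: "'a::comm_ring_1"
  shows "5 dvd (1 - (1 - x) ^ (5 ^ r)) - x ^ (5 ^ r)"
proof (induction r)
  case (Suc r)
  define a where "a = (1 - x) ^ (5 ^ r)"
  define b where "b = x ^ (5 ^ r)"
  have "5 dvd (1 - a) - b" using Suc by (simp add: a_def b_def)
  then have "5 dvd (1 - a) ^ 5 - b ^ 5"
    by (metis power_diff_sumr2 dvd_mult2)
  moreover have "5 dvd (1 - a) ^ 5 - (1 - a ^ 5)"
    using freshman_5 [of 1 a] by simp
  ultimately have "5 dvd ((1 - a) ^ 5 - b ^ 5) - ((1 - a) ^ 5 - (1 - a ^ 5))"
    by (rule dvd_diff)
  then show ?case
    by (simp add: a_def b_def power_mult [symmetric] mult.commute)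
qed simp

lemma fps_nth_mult_one_minus_power:
  fixes g :: "int fps"
  shows "[fps_nth ((1 - p ^ 5 ^ r) * g) n = (if n < 5 ^ r then 0 else fps_nth g (n - 5 ^ r))] (mod 5)"
proof -
  have "5 dvd ((1 - p ^ 5 ^ r) - fps_X ^ 5 ^ r) * g"
    using one_minus_power_5 [of "fps_X :: int fps" r] by (rule dvd_mult2)
  then have "5 dvd fps_nth ((1 - p ^ 5 ^ r) * g - fps_X ^ 5 ^ r * g) n"
    by (intro fps_nth_dvd_5) (simp only: left_diff_distrib)
  then show ?thesis
    by (simp add: cong_iff_dvd_diff fps_X_power_mult_nth split: if_splits)
qed

section \<open>Series without terms of exponent 4 modulo 5\<close>

definition vanishing_4_mod_5 :: "int fps set" where
  "vanishing_4_mod_5 = {f. \<forall>n. 5 dvd fps_nth f (5 * n + 4)}"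

lemma vanishing_add: "f \<in> vanishing_4_mod_5 \<Longrightarrow> g \<in> vanishing_4_mod_5 \<Longrightarrow> f + g \<in> vanishing_4_mod_5"
  and vanishing_diff: "f \<in> vanishing_4_mod_5 \<Longrightarrow> g \<in> vanishing_4_mod_5 \<Longrightarrow> f - g \<in> vanishing_4_mod_5"
  by (simp_all add: vanishing_4_mod_5_def)

text \<open>Modulo 5, \<open>p^5 = 1 - t^5\<close> mixes only coefficients whose indices agree modulo 5.\<close>

lemma vanishing_mult_power_5:
  assumes "f \<in> vanishing_4_mod_5"
  shows "p ^ (5 * j) * f \<in> vanishing_4_mod_5"
proof (induction j)
  case (Suc j)
  define g where "g = p ^ (5 * j) * f"
  have "5 dvd (1 - p ^ 5) - fps_X ^ 5"
    using one_minus_power_5 [of "fps_X :: int fps" 1] by simp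
  then have "5 dvd ((1 - p ^ 5) - fps_X ^ 5) * g" by simp
  then have "5 dvd fps_nth (((1 - p ^ 5) - fps_X ^ 5) * g) n" for n by (rule fps_nth_dvd_5)
  then have *: "5 dvd fps_nth g n - fps_nth (fps_X ^ 5 * g) n - fps_nth (p ^ 5 * g) n" for n
    by (simp add: algebra_simps)
  have "5 dvd fps_nth (p ^ 5 * g) (5 * n + 4)" for n
  proof -
    have g: "5 dvd fps_nth g (5 * n + 4)" for n
      using Suc by (simp add: g_def vanishing_4_mod_5_def)
    have "5 dvd fps_nth (fps_X ^ 5 * g) (5 * n + 4)"
    proof (cases n)
      case (Suc m)
      then show ?thesis using g [of m] by (simp add: fps_X_power_mult_nth add.commute)
    qed (simp add: fps_X_power_mult_nth)
    then show ?thesis using * [of "5 * n + 4"] g [of n] by presburger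
  qed
  then have "p ^ 5 * g \<in> vanishing_4_mod_5" by (simp add: vanishing_4_mod_5_def)
  then show ?case by (simp add: g_def power_add mult_ac)
qed (use assms in simp)

text \<open>
  After removing powers of \<open>p^5\<close>, only \<open>p^0\<close> and \<open>p^3\<close> remain, and their degrees are less than 4.
\<close>

lemma power_vanishing:
  assumes "e mod 5 = 0 \<or> e mod 5 = 3"
  shows "p ^ e \<in> vanishing_4_mod_5"
proof -
  have "p ^ (e mod 5) \<in> vanishing_4_mod_5"
    using assms
  proof
    assume "e mod 5 = 0"
    then show ?thesis by (simp add: vanishing_4_mod_5_def)
  next
    assume e: "e mod 5 = 3"
    have "p ^ 3 = 1 - fps_const 3 * fps_X ^ 1 + fps_const 3 * fps_X ^ 2 - fps_X ^ 3"
      by (simp add: fps_numeral_fps_const [symmetric] eval_nat_numeral algebra_simps)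
    also have "\<dots> \<in> vanishing_4_mod_5"
      unfolding vanishing_4_mod_5_def by (simp add: fps_X_power_nth del: power_one_right)
    finally show ?thesis using e by simp
  qed
  then have "p ^ (5 * (e div 5)) * p ^ (e mod 5) \<in> vanishing_4_mod_5"
    by (rule vanishing_mult_power_5)
  then show ?thesis by (simp add: power_add [symmetric])
qed

section \<open>Self-similarity of the truncated theta series\<close>

text \<open>
  The two exceptional powers of \<open>p\<close> produced by five steps of the recurrence at \<open>p\<close> are cancelled by
  the explicit terms of one step of the recurrence at \<open>p^25\<close>. The assumption is
  \<open>p^(75 m + 35)\<close> times the conclusion for \<open>m - 1\<close>; multiplied out in this way it has no negative
  exponent at \<open>m = 0\<close>, where it is trivial.
\<close>

lemma zagier_theta_mult_5_step:
  assumes "p ^ (75*m+35) * zagier_theta (5 * m) p + p ^ (85*m+34) * zagier_theta m (p ^ 25)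
    \<in> vanishing_4_mod_5" (is "?f \<in> _")
  shows "zagier_theta (5 * Suc m) p + p ^ (10*m+9) * zagier_theta (Suc m) (p ^ 25)
    \<in> vanishing_4_mod_5"
proof -
  have "zagier_theta (Suc m) (p ^ 25)
      = 1 - p ^ (50*m+25) - p ^ (75*m+25) * zagier_theta m (p ^ 25)"
    unfolding zagier_theta_Suc power_mult [symmetric] by (simp add: algebra_simps)
  then have t: "p ^ (10*m+9) * zagier_theta (Suc m) (p ^ 25)
      = p ^ (10*m+9) - p ^ (60*m+34) - p ^ (85*m+34) * zagier_theta m (p ^ 25)"
    by (simp only: right_diff_distrib mult_1_right mult.assoc [symmetric] power_add [symmetric])
      (simp add: algebra_simps)
  have "zagier_theta (5 * Suc m) p
     = 1 - p ^ (10*m+9) - p ^ (15*m+13) + p ^ (25*m+20) + p ^ (30*m+23) - p ^ (40*m+28)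
       - p ^ (45*m+30) + p ^ (55*m+33) + p ^ (60*m+34) - p ^ (70*m+35)
       - p ^ (75*m+35) * zagier_theta (5 * m) p"
    using zagier_theta_add_5 [of "5 * m" p] by (simp add: mult.assoc [symmetric] add.commute)
  then have "zagier_theta (5 * Suc m) p + p ^ (10*m+9) * zagier_theta (Suc m) (p ^ 25)
     = p ^ 0 - p ^ (15*m+13) + p ^ (25*m+20) + p ^ (30*m+23) - p ^ (40*m+28)
       - p ^ (45*m+30) + p ^ (55*m+33) - p ^ (70*m+35) - ?f"
    unfolding t by simp
  also have "\<dots> \<in> vanishing_4_mod_5"
    by (intro vanishing_add vanishing_diff power_vanishing assms; presburger)
  finally show ?thesis .
qed

text \<open>
  Up to the factor \<open>- p ^ (10*m+9)\<close>, \<open>zagier_theta (Suc m) (p ^ 25)\<close> collects the powers of \<open>p\<close> in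
  \<open>zagier_theta (5 * Suc m) p\<close> with exponent 4 modulo 5.
\<close>

lemma zagier_theta_mult_5:
  "zagier_theta (5 * Suc m) p + p ^ (10*m+9) * zagier_theta (Suc m) (p ^ 25)
    \<in> vanishing_4_mod_5"
proof (induction m)
  case 0
  show ?case
    by (rule zagier_theta_mult_5_step) (simp add: vanishing_4_mod_5_def)
next
  case (Suc m)
  have "p ^ (5 * (15*m+22)) * (zagier_theta (5 * Suc m) p
      + p ^ (10*m+9) * zagier_theta (Suc m) (p ^ 25)) \<in> vanishing_4_mod_5"
    by (rule vanishing_mult_power_5) (rule Suc)
  also have "p ^ (5 * (15*m+22)) * (zagier_theta (5 * Suc m) p
      + p ^ (10*m+9) * zagier_theta (Suc m) (p ^ 25))
    = p ^ (75 * Suc m + 35) * zagier_theta (5 * Suc m) p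
      + p ^ (85 * Suc m + 34) * zagier_theta (Suc m) (p ^ 25)"
    by (simp only: distrib_left mult.assoc [symmetric] power_add [symmetric])
      (simp add: algebra_simps)
  finally show ?case by (rule zagier_theta_mult_5_step)
qed

section \<open>The congruence\<close>

text \<open>
  This is \<open>F(1/p) = S(p^k) / (1 - p^k)\<close> modulo 5 and \<open>t^k\<close> for \<open>k = 5^r\<close>: the terms of \<open>F\<close> from the
  \<open>k\<close>-th on are divisible by \<open>t^k\<close>, and the others agree modulo \<open>1 - p^k\<close>, which is \<open>t^k\<close> modulo 5.
\<close>

lemma xi_minus_one_cong:
  assumes "n < 5 ^ r"
  shows "[xi_minus_one n = fps_nth (zagier_sum (5 ^ r) p) n] (mod 5)"
proof -
  let ?F = "\<lambda>j. \<Prod>i=1..j. (1 - inv_one_minus_q ^ i)"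
  have u0: "fps_nth inv_one_minus_q 0 = 1" by (simp add: inv_one_minus_q_def)
  have "xi_minus_one n = (\<Sum>j\<le>n. fps_nth (?F j) n)"
    unfolding xi_minus_one_def F_series_def sums_unique [OF sums_F_series [OF u0], symmetric]
    by simp
  also have "\<dots> = (\<Sum>j<5 ^ r. fps_nth (?F j) n)"
    using assms F_series_term_nth_eq_0 [OF u0] by (intro sum.mono_neutral_left) auto
  finally have xi: "xi_minus_one n = fps_nth (\<Sum>j<5 ^ r. ?F j) n"
    by (simp add: fps_sum_nth)
  obtain g where "zagier_sum (5 ^ r) p - (\<Sum>j<5 ^ r. ?F j) = (1 - p ^ 5 ^ r) * g"
    using dvd_zagier_sum_diff [OF inv_one_minus_q_inverse] by (rule dvdE)
  then have "[fps_nth (zagier_sum (5 ^ r) p - (\<Sum>j<5 ^ r. ?F j)) n = 0] (mod 5)"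
    using fps_nth_mult_one_minus_power [of r g n] assms by simp
  then show ?thesis
    unfolding xi by (simp add: cong_iff_dvd_diff dvd_diff_commute)
qed

text \<open>
  The coefficient is read off from \<open>zagier_theta (5 ^ Suc r) p\<close> at the index \<open>e\<close>, shifted by
  \<open>5 ^ Suc r\<close> to account for the factor \<open>1 - p ^ 5 ^ Suc r\<close>. The choice of \<open>r\<close> only has to ensure
  \<open>5 * n + 4 < 5 ^ Suc r\<close>.
\<close>

theorem mainTheorem6:
  fixes n :: nat
  shows "[xi_minus_one (5 * n + 4) = 0] (mod 5)"
proof -
  define r where "r = 5 * n + 4"
  define e where "e = 5 * n + 4 + 5 ^ Suc r"
  obtain m where m: "5 ^ r = Suc m"
    by (metis not0_implies_Suc power_not_zero zero_neq_numeral)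
  have "Suc r < 5 ^ Suc r" by (rule power_gt_expt) simp
  then have "r < 5 ^ Suc r" by linarith
  then have small: "5 * n + 4 < 5 ^ Suc r" by (simp only: r_def)
  have "e = 5 * (n + 5 ^ r) + 4" by (simp add: e_def)
  moreover have "zagier_theta (5 ^ Suc r) p + p ^ (10*m+9) * zagier_theta (Suc m) (p ^ 25)
      \<in> vanishing_4_mod_5"
    unfolding power_Suc m by (rule zagier_theta_mult_5)
  ultimately have "5 dvd fps_nth (zagier_theta (5 ^ Suc r) p
      + p ^ (10*m+9) * zagier_theta (Suc m) (p ^ 25)) e"
    by (simp only: vanishing_4_mod_5_def mem_Collect_eq)
  \<comment> \<open>Modulo 5 the factor \<open>1 - p ^ 5 ^ (r + 2)\<close> pushes this part beyond the index \<open>e < 2 * 5 ^ Suc r\<close>.\<close>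
  moreover have "[fps_nth (p ^ (10*m+9) * zagier_theta (Suc m) (p ^ 25)) e = 0] (mod 5)"
  proof -
    have "(p ^ 25) ^ Suc m = p ^ (5 ^ (r + 2))"
      by (simp add: m [symmetric] power_mult [symmetric] mult.commute)
    then have "p ^ (10*m+9) * zagier_theta (Suc m) (p ^ 25)
        = (1 - p ^ (5 ^ (r + 2))) * (p ^ (10*m+9) * zagier_sum (Suc m) (p ^ 25))"
      by (simp only: zagier_theta_def mult.left_commute)
    moreover have "e < 5 ^ (r + 2)"
      using small by (simp add: e_def)
    ultimately show ?thesis
      using fps_nth_mult_one_minus_power
        [of "r + 2" "p ^ (10*m+9) * zagier_sum (Suc m) (p ^ 25)" e]
      by (simp only: if_True)
  qed
  ultimately have "[fps_nth (zagier_theta (5 ^ Suc r) p) e = 0] (mod 5)"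
    by (simp add: cong_0_iff dvd_add_left_iff)
  moreover have "[fps_nth (zagier_theta (5 ^ Suc r) p) e
      = fps_nth (zagier_sum (5 ^ Suc r) p) (5 * n + 4)] (mod 5)"
    using fps_nth_mult_one_minus_power [of "Suc r" "zagier_sum (5 ^ Suc r) p" e]
    by (simp add: zagier_theta_def e_def del: power_Suc)
  ultimately show ?thesis
    using xi_minus_one_cong [OF small] by (meson cong_sym cong_trans)
qed

end
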